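(* The quantity $H_n=H_n(t)$ satisfies the following second-order differential equation (prime denoting $d/dt$): $$\begin{aligned}&\Big\{4t^3(H_n'')^2+4t^2H_n''\left[H_n'-2(t+\alpha)\right]+8t^2(H_n')^3-t(H_n')^2\left[4H_n+4(t+\alpha)^2-32nt-1\right]\\&\quad-4tH_n'\left[4(2n+\alpha+t)H_n+(3t+\alpha)(4nt+4n\alpha+1)\right]+8(n+\alpha+t)H_n^2\\&\quad+4H_n\left[2t^3+6t^2(n+\alpha)+t(8n\alpha+6\alpha^2+1)+2\alpha^2(n+\alpha)\right]+8t(t+\alpha)^2\left[2n(t+\alpha)+1\right]\Big\}^2\\&=16\left[H_n-2tH_n'+(t+\alpha)^2\right]\Big\{2t^2H_n''+t(4H_n+8nt+1)H_n'-2H_n^2-2H_n\left[2nt+(t+\alpha)^2\right]\\&\quad-2t(t+\alpha)\left[2n(t+\alpha)+1\right]\Big\}^2,\end{aligned}$$ with the initial conditions $$H_n(0)=n(n+2\alpha),\qquad H_n'(0)=-\frac{2n(2n^2+2n\alpha-1)}{(2n-1+2\alpha)(2n+1+2\alpha)}.$$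
   Context: Let $\alpha>-1$, $t\in\mathbb{R}$ and $w(x,t)=(1-x^2)^{\alpha}e^{-tx^2}$ for $x\in[-1,1]$. Let $P_n(x,t)$, $n=0,1,2,\ldots$, be the monic polynomials of degree $n$ orthogonal with respect to $w$: $\int_{-1}^1P_m(x,t)P_n(x,t)w(x,t)\,dx=h_n(t)\delta_{mn}$. Define $$R_n(t):=\frac{2\alpha}{h_n(t)}\int_{-1}^1\frac{1}{1-y^2}P_n^2(y,t)\,w(y,t)\,dy,\qquad H_n(t):=\sum_{j=0}^{n-1}R_j(t).$$
   Formalization: For -1<α≤0 the integral defining R_n diverges; it is read as its analytic continuation in α (boundary term of the integration by parts removed). The formula for H_n'(0) is asserted only when its denominator is nonzero; otherwise it reads 0/0. *)

theory Defs
  imports "HOL-Analysis.Analysis" "HOL-Computational_Algebra.Polynomial"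
begin

definition w :: "real \<Rightarrow> real \<Rightarrow> real \<Rightarrow> real" where
  "w \<alpha> t x = (1 - x\<^sup>2) powr \<alpha> * exp (- t * x\<^sup>2)"

definition monic_orthogonal ::
  "(real \<Rightarrow> real) \<Rightarrow> (nat \<Rightarrow> real poly) \<Rightarrow> (nat \<Rightarrow> real) \<Rightarrow> bool" where
  "monic_orthogonal v p h \<longleftrightarrow>
     (\<forall>n. degree (p n) = n \<and> lead_coeff (p n) = 1) \<and>
     (\<forall>m n. (LINT x:{-1..1}|lborel. poly (p m) x * poly (p n) x * v x) =
            (if m = n then h n else 0))"

(* The integral 2 alpha * int_{-1}^1 p(y)^2 w(y,t) / (1 - y^2) dy.

   For alpha > 0 it converges and is taken literally.  For -1 < alpha <= 0 it diverges
   (unless p vanishes at the endpoints), and it is read as its analytic continuation in alpha,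
   obtained by integrating by parts.  Since
     2 alpha y (1 - y^2)^(alpha - 1) = - d/dy (1 - y^2)^alpha,
   the integral over [-a, a] differs from a quantity that converges as a -> 1 exactly by the
   boundary term - [y p(y)^2 w(y,t)]_{y = -a}^{y = a}; the regularised value drops this term.
   For alpha > 0 the boundary term tends to 0 and the two clauses would agree. *)
definition sing_integral :: "real \<Rightarrow> real \<Rightarrow> real poly \<Rightarrow> real" where
  "sing_integral \<alpha> t p =
     (if \<alpha> > 0
      then 2 * \<alpha> * (LINT y:{-1..1}|lborel. 1 / (1 - y\<^sup>2) * (poly p y)\<^sup>2 * w \<alpha> t y)
      else Lim (at_left 1) (\<lambda>a.
             2 * \<alpha> * (LINT y:{-a..a}|lborel. 1 / (1 - y\<^sup>2) * (poly p y)\<^sup>2 * w \<alpha> t y)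
             + (a * (poly p a)\<^sup>2 * w \<alpha> t a - (-a) * (poly p (-a))\<^sup>2 * w \<alpha> t (-a))))"

definition R ::
  "real \<Rightarrow> (nat \<Rightarrow> real \<Rightarrow> real poly) \<Rightarrow> (nat \<Rightarrow> real \<Rightarrow> real) \<Rightarrow> nat \<Rightarrow> real \<Rightarrow> real" where
  "R \<alpha> P h n t = sing_integral \<alpha> t (P n t) / h n t"

definition H ::
  "real \<Rightarrow> (nat \<Rightarrow> real \<Rightarrow> real poly) \<Rightarrow> (nat \<Rightarrow> real \<Rightarrow> real) \<Rightarrow> nat \<Rightarrow> real \<Rightarrow> real" where
  "H \<alpha> P h n t = (\<Sum>j<n. R \<alpha> P h j t)"

end

theory Submission
  imports Defs
begin

text \<open>
Everything is carried by the recurrence coefficients $\<beta>_n = h_n/h_{n-1}$ in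
$xP_n = P_{n+1} + \<beta>_n P_{n-1}$.

Integration by parts turns the singular integral in $R_n$ into
$R_n = 2n + 1 + 2\<alpha> - 2t(\<beta>_n + \<beta>_{n+1})$, for all $\<alpha> > -1$, so that
$H_n = n^2 + 2n\<alpha> - 2tS_n$ with $S_n = \<Sum>_{j<n} (\<beta>_j + \<beta>_{j+1})$. Two structures determine the
$\<beta>$'s. In $n$, the vanishing integral of $((1-x^2)P_nP_{n-1}w)'$ gives the string equation (lemma
string_equation), which expresses $S_n$ by $\<beta>_{n-1}, \<beta>_n, \<beta>_{n+1}$; summing its differences
gives, for $r = n - 2t\<beta>_n$, the quadratic relation $r^2 + 2\<alpha>r = \<beta>_nR_nR_{n-1}$ (lemma
r_quadratic). In $t$, the formula $h_n' = -\<integral>x^2P_n^2w$ gives the Volterra lattice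
$\<beta>_n' = \<beta>_n(\<beta>_{n-1} - \<beta>_{n+1})$ (lemma DERIV_b), from which $H_n$ is twice differentiable.

These combine into three relations:
$r^2 + 2(t+\<alpha>)r = H_n - 2tH_n'$, $r' = -\<beta>_n(R_n - R_{n-1})$ and $H_n' + 2r = \<beta>_n(R_n + R_{n-1})$.
Subtracting the squares of the last two and using the quadratic relation and $2t\<beta>_n = n - r$ leaves
an equation in $r$, $r'$ and $H_n'$ (lemma r_first_order). The first relation, differentiated,
expresses $r'$ by $H_n''$; and it shows that $Q = r + t + \<alpha>$ is a square root of
$H_n - 2tH_n' + (t+\<alpha>)^2$. Separating even and odd powers of $Q$ and squaring removes $Q$ and leaves
the differential equation (lemma quartic_resolvent). At $t = 0$ the quadratic relation determines
$\<beta>_n(0)$, and the string equation then gives $S_n(0) = -H_n'(0)/2$.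
\<close>

section \<open>Weighted integrals of polynomials\<close>

definition wint :: "real \<Rightarrow> real \<Rightarrow> real poly \<Rightarrow> real" where
  "wint \<alpha> t p = (LINT x:{-1..1}|lborel. poly p x * w \<alpha> t x)"

text \<open>Substituting $x = 2u - 1$ turns the weight into a multiple of $u^\<alpha> (1-u)^\<alpha>$, the integrand of a Beta function.\<close>
lemma jacobi_weight_integrable:
  assumes "\<alpha> > -1"
  shows "set_integrable lborel {-1..1::real} (\<lambda>x. (1 - x\<^sup>2) powr \<alpha>)"
proof -
  let ?f = "\<lambda>u::real. u powr \<alpha> * (1 - u) powr \<alpha>"
  have "integrable lborel (\<lambda>u. indicator {0..1} u *\<^sub>R ?f u)"
    using integrable_Beta[of "\<alpha> + 1" "\<alpha> + 1"] assms by (simp add: set_integrable_def)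
  hence "integrable lborel (\<lambda>x. indicator {0..1} (1/2 + 1/2 * x) *\<^sub>R ?f (1/2 + 1/2 * x))"
    by (rule lborel_integrable_real_affine) simp
  hence "integrable lborel (\<lambda>x. 4 powr \<alpha> * (indicator {0..1} (1/2 + 1/2 * x) *\<^sub>R ?f (1/2 + 1/2 * x)))"
    by (rule integrable_mult_right)
  also have "(\<lambda>x. 4 powr \<alpha> * (indicator {0..1} (1/2 + 1/2 * x) *\<^sub>R ?f (1/2 + 1/2 * x))) =
             (\<lambda>x. indicator {-1..1} x *\<^sub>R (1 - x\<^sup>2) powr \<alpha>)"
  proof
    fix x :: real
    show "4 powr \<alpha> * (indicator {0..1} (1/2 + 1/2 * x) *\<^sub>R ?f (1/2 + 1/2 * x)) =
          indicator {-1..1} x *\<^sub>R (1 - x\<^sup>2) powr \<alpha>"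
    proof (cases "x \<in> {-1..1}")
      case True
      have "1 - x\<^sup>2 = 4 * ((1/2 + 1/2 * x) * (1 - (1/2 + 1/2 * x)))"
        by (simp add: power2_eq_square field_simps)
      also have "\<dots> powr \<alpha> = 4 powr \<alpha> * ?f (1/2 + 1/2 * x)"
        using True by (simp add: powr_mult)
      finally show ?thesis using True by (simp add: indicator_def)
    next
      case False
      thus ?thesis by (auto simp: indicator_def)
    qed
  qed
  finally show ?thesis by (simp add: set_integrable_def)
qed

lemma weight_integrable:
  assumes "\<alpha> > -1" and g: "continuous_on {-1..1} g"
  shows "set_integrable lborel {-1..1} (\<lambda>x. g x * w \<alpha> t x)"
proof -
  define G where "G x = g x * exp (- t * x\<^sup>2)" for x
  have cG: "continuous_on {-1..1} G"
    unfolding G_def by (rule continuous_on_mult[OF g], intro continuous_intros)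
  have "compact (G ` {-1..1})"
    by (rule compact_continuous_image[OF cG]) simp
  then obtain B where B: "\<And>x. x \<in> {-1..1} \<Longrightarrow> \<bar>G x\<bar> \<le> B"
    by (metis bounded_real compact_imp_bounded imageI)
  have int: "set_integrable lborel {-1..1::real} (\<lambda>x. B * (1 - x\<^sup>2) powr \<alpha>)"
    by (intro set_integrable_mult_right jacobi_weight_integrable assms)
  have m1: "(\<lambda>x. indicator {-1..1} x *\<^sub>R G x) \<in> borel_measurable borel"
    by (intro borel_measurable_continuous_on_indicator cG) simp
  have m2: "(\<lambda>x::real. (1 - x\<^sup>2) powr \<alpha>) \<in> borel_measurable borel"
    by measurable
  have "set_integrable lborel {-1..1} (\<lambda>x. G x * (1 - x\<^sup>2) powr \<alpha>)"
  proof (rule set_integrable_bound[OF int])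
    show "set_borel_measurable lborel {-1..1} (\<lambda>x. G x * (1 - x\<^sup>2) powr \<alpha>)"
      using borel_measurable_times[OF m1 m2]
      by (simp add: set_borel_measurable_def mult.assoc)
    show "AE x in lborel. x \<in> {- 1..1} \<longrightarrow>
        norm (G x * (1 - x\<^sup>2) powr \<alpha>) \<le> norm (B * (1 - x\<^sup>2) powr \<alpha>)"
    proof (rule AE_I2, rule impI)
      fix x :: real assume "x \<in> {-1..1}"
      hence "\<bar>G x\<bar> \<le> \<bar>B\<bar>" using B by fastforce
      thus "norm (G x * (1 - x\<^sup>2) powr \<alpha>) \<le> norm (B * (1 - x\<^sup>2) powr \<alpha>)"
        by (simp add: abs_mult mult_right_mono)
    qed
  qed
  thus ?thesis by (simp add: G_def w_def mult.assoc mult.commute mult.left_commute)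
qed

lemma poly_weight_integrable:
  "\<alpha> > -1 \<Longrightarrow> set_integrable lborel {-1..1} (\<lambda>x. poly p x * w \<alpha> t x)"
  by (intro weight_integrable continuous_intros)

lemma wint_has_integral:
  assumes "\<alpha> > -1"
  shows "((\<lambda>x. poly p x * w \<alpha> t x) has_integral wint \<alpha> t p) {-1..1}"
  using set_borel_integral_eq_integral[OF poly_weight_integrable[OF assms, of p t]]
  by (simp add: wint_def has_integral_iff)

lemma wint_add: "\<alpha> > -1 \<Longrightarrow> wint \<alpha> t (p + q) = wint \<alpha> t p + wint \<alpha> t q"
  unfolding wint_def using poly_weight_integrable[of \<alpha> p t] poly_weight_integrable[of \<alpha> q t]
  by (simp add: distrib_right set_integral_add)

lemma wint_smult: "wint \<alpha> t (smult c p) = c * wint \<alpha> t p"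
  unfolding wint_def by (simp add: mult.assoc)

lemma wint_reflect: "wint \<alpha> t (pcompose p [:0, -1:]) = wint \<alpha> t p"
  unfolding wint_def
  by (subst (2) set_lebesgue_integral_def, subst lborel_integral_real_affine[where c="-1" and t=0])
     (auto simp: set_lebesgue_integral_def poly_pcompose w_def indicator_def intro!: Bochner_Integration.integral_cong)

text \<open>The weight is positive inside the interval, so the integral of a square can vanish only if the
polynomial does almost everywhere there; a nonzero polynomial has finitely many roots.\<close>
lemma wint_square_pos:
  assumes "\<alpha> > -1" "p \<noteq> 0"
  shows "wint \<alpha> t (p * p) > 0"
proof -
  let ?f = "\<lambda>x. indicator {-1..1} x *\<^sub>R (poly (p * p) x * w \<alpha> t x)"
  have int: "integrable lborel ?f"
    using poly_weight_integrable[OF assms(1), of "p * p" t] by (simp add: set_integrable_def)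
  have nn: "?f x \<ge> 0" for x by (auto simp: w_def)
  have "wint \<alpha> t (p * p) \<noteq> 0"
  proof
    assume "wint \<alpha> t (p * p) = 0"
    hence "integral\<^sup>L lborel ?f = 0" by (simp add: wint_def set_lebesgue_integral_def)
    hence "AE x in lborel. ?f x = 0"
      using integral_nonneg_eq_0_iff_AE[OF int] nn by simp
    moreover have "AE x in lborel. x \<notin> {x. poly p x = 0}"
      by (rule AE_not_in) (use poly_roots_finite[OF assms(2)] in \<open>simp add: finite_imp_null_set_lborel\<close>)
    ultimately have "AE x in lborel. x \<notin> {-1<..<1::real}"
    proof eventually_elim
      case (elim x)
      have "1 - x\<^sup>2 > 0" if "x \<in> {-1<..<1}"
        using that by (simp add: abs_square_less_1 abs_less_iff)
      with elim show ?case by (auto simp: w_def)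
    qed
    hence "{-1<..<1::real} \<in> null_sets lborel"
      by (subst (asm) AE_iff_null_sets[symmetric]) auto
    thus False by (simp add: null_sets_def)
  qed
  moreover have "wint \<alpha> t (p * p) \<ge> 0"
    unfolding wint_def set_lebesgue_integral_def by (intro Bochner_Integration.integral_nonneg nn)
  ultimately show ?thesis by simp
qed

text \<open>Lowering or raising the exponent by one is division or multiplication by $1 - x^2$; at
$x = \<plusminus>1$ this rests on $0$ powr $c = 0$ and division by zero giving zero.\<close>
lemma w_minus_one:
  assumes "x \<in> {-1..1}"
  shows "w (\<alpha> - 1) t x = w \<alpha> t x / (1 - x\<^sup>2)"
  using assms by (simp add: w_def powr_diff abs_square_le_1 abs_le_iff)

lemma w_plus_one:
  assumes "x \<in> {-1..1}"
  shows "w (\<alpha> + 1) t x = (1 - x\<^sup>2) * w \<alpha> t x"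
  using assms by (simp add: w_def powr_add abs_square_le_1 abs_le_iff)

lemma DERIV_poly_weight:
  assumes "x \<in> {-1<..<1}"
  shows "((\<lambda>x. poly p x * w \<gamma> t x) has_real_derivative
          (poly (pderiv p) x - 2 * t * x * poly p x) * w \<gamma> t x - 2 * \<gamma> * x * poly p x * w (\<gamma> - 1) t x) (at x)"
proof -
  have "1 - x\<^sup>2 > 0" using assms by (simp add: abs_square_less_1 abs_less_iff)
  thus ?thesis unfolding w_def
    by (auto intro!: derivative_eq_intros DERIV_powr simp: algebra_simps powr_diff)
qed

lemma continuous_on_poly_weight:
  "\<gamma> > 0 \<Longrightarrow> continuous_on {-1..1} (\<lambda>x. poly p x * w \<gamma> t x)"
  unfolding w_def by (intro continuous_intros continuous_on_powr') (auto simp: abs_square_le_1 abs_le_iff)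

lemma continuous_on_poly_weight_inside:
  assumes "a < 1"
  shows "continuous_on {-a..a} (\<lambda>x. poly p x * w \<gamma> t x)"
proof -
  have "x\<^sup>2 \<noteq> 1" if "x \<in> {-a..a}" for x using that assms by (auto simp: power2_eq_1_iff)
  thus ?thesis unfolding w_def by (intro continuous_intros continuous_on_powr) auto
qed

lemma poly_weight_deriv_has_integral:
  assumes "0 \<le> a" "a \<le> 1" and "continuous_on {-a..a} (\<lambda>x. poly p x * w \<gamma> t x)"
  shows "((\<lambda>x. (poly (pderiv p) x - 2 * t * x * poly p x) * w \<gamma> t x
            - 2 * \<gamma> * x * poly p x * w (\<gamma> - 1) t x)
          has_integral (poly p a * w \<gamma> t a - poly p (-a) * w \<gamma> t (-a))) {-a..a}"
  using assms
  by (intro fundamental_theorem_of_calculus_interior)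
     (auto simp: has_real_derivative_iff_has_vector_derivative[symmetric] intro!: DERIV_poly_weight)

lemma w_endpoint: "w \<gamma> t 1 = 0" "w \<gamma> t (-1) = 0"
  by (simp_all add: w_def)

text \<open>The integral of $((1-x^2)\,p\,w)'$ vanishes: raising the exponent to $\<alpha> + 1 > 0$ removes the boundary
terms for every $\<alpha> > -1$. Every relation between recurrence coefficients of different degrees at a
fixed $t$ comes from this identity.\<close>
lemma wint_pearson:
  assumes "\<alpha> > -1"
  shows "wint \<alpha> t ([:1, 0, -1:] * pderiv p - smult (2 * (\<alpha> + 1)) ([:0, 1:] * p)
            - smult (2 * t) ([:0, 1:] * [:1, 0, -1:] * p)) = 0" (is "wint \<alpha> t ?q = 0")
proof -
  have "((\<lambda>x. (poly (pderiv p) x - 2 * t * x * poly p x) * w (\<alpha> + 1) t x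
            - 2 * (\<alpha> + 1) * x * poly p x * w (\<alpha> + 1 - 1) t x) has_integral 0) {-1..1}"
    using poly_weight_deriv_has_integral[of 1 p "\<alpha> + 1" t]
      continuous_on_poly_weight[of "\<alpha> + 1" p t] assms by (simp add: w_endpoint)
  moreover have "(poly (pderiv p) x - 2 * t * x * poly p x) * w (\<alpha> + 1) t x
            - 2 * (\<alpha> + 1) * x * poly p x * w (\<alpha> + 1 - 1) t x = poly ?q x * w \<alpha> t x"
    if "x \<in> {-1..1}" for x
    unfolding w_plus_one[OF that] by (simp add: algebra_simps power2_eq_square)
  ultimately have "((\<lambda>x. poly ?q x * w \<alpha> t x) has_integral 0) {-1..1}"
    by (rule has_integral_eq[rotated])
  from has_integral_unique[OF wint_has_integral[OF assms] this] show ?thesis .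
qed

text \<open>Writing $1/(1-y^2) = 1 + y^2/(1-y^2)$ and integrating the second part by parts replaces the singular
integral by a convergent integral of a polynomial. For $\<alpha> > 0$ the boundary terms vanish; for
$\<alpha> \<le> 0$ they are exactly those which the regularisation removes. Both readings of the
singular integral therefore give the same formula.\<close>
lemma sing_integral_eq_wint:
  assumes "\<alpha> > -1"
  shows "sing_integral \<alpha> t p = wint \<alpha> t (smult (2 * \<alpha>) (p * p) + pderiv ([:0, 1:] * (p * p))
            - smult (2 * t) ([:0, 0, 1:] * (p * p)))" (is "_ = wint \<alpha> t ?q")
proof -
  define s where "s = [:0, 1:] * (p * p)"
  let ?F = "\<lambda>x. poly s x * w \<alpha> t x"
  let ?F' = "\<lambda>x. (poly (pderiv s) x - 2 * t * x * poly s x) * w \<alpha> t x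
            - 2 * \<alpha> * x * poly s x * w (\<alpha> - 1) t x"
  let ?g = "\<lambda>x. 1 / (1 - x\<^sup>2) * (poly p x)\<^sup>2 * w \<alpha> t x"
  have pw: "poly ?q x * w \<alpha> t x - ?F' x = 2 * \<alpha> * ?g x" if "x \<in> {-1..1}" for x
  proof (cases "x\<^sup>2 = 1")
    case True
    hence "w \<alpha> t x = 0" by (simp add: w_def)
    thus ?thesis using w_minus_one[OF that, of \<alpha> t] by simp
  next
    case False
    hence "1 - x\<^sup>2 \<noteq> 0" by simp
    thus ?thesis unfolding w_minus_one[OF that] s_def
      by (simp add: field_simps) (simp add: power2_eq_square algebra_simps)
  qed
  show ?thesis
  proof (cases "\<alpha> > 0")
    case True
    have "set_integrable lborel {-1..1} (\<lambda>x. (poly p x)\<^sup>2 * w (\<alpha> - 1) t x)"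
      using True by (intro weight_integrable continuous_intros) auto
    hence int: "set_integrable lborel {-1..1} ?g"
      by (rule set_integrable_cong[THEN iffD1, OF refl refl, rotated]) (auto simp: w_minus_one)
    have "(?F' has_integral 0) {-1..1}"
      using poly_weight_deriv_has_integral[of 1 s \<alpha> t] continuous_on_poly_weight[OF True, of s t]
      by (simp add: w_endpoint)
    from has_integral_eq[OF pw has_integral_diff[OF wint_has_integral[OF assms, of ?q t] this]]
    have "((\<lambda>x. 2 * \<alpha> * ?g x) has_integral wint \<alpha> t ?q) {-1..1}"
      by (simp only: diff_0_right)
    hence "integral {-1..1} (\<lambda>x. 2 * \<alpha> * ?g x) = wint \<alpha> t ?q"
      by (rule integral_unique)
    hence "2 * \<alpha> * integral {-1..1} ?g = wint \<alpha> t ?q"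
      by (simp only: integral_mult_right)
    thus ?thesis using True set_borel_integral_eq_integral(2)[OF int]
      by (simp add: sing_integral_def)
  next
    case False
    let ?I = "\<lambda>u. integral {-1..u} (\<lambda>x. poly ?q x * w \<alpha> t x)"
    have qint: "(\<lambda>x. poly ?q x * w \<alpha> t x) integrable_on {-1..1}"
      using wint_has_integral[OF assms, of ?q t] by blast
    have ev: "2 * \<alpha> * (LINT y:{-a..a}|lborel. ?g y)
        + (a * (poly p a)\<^sup>2 * w \<alpha> t a - (-a) * (poly p (-a))\<^sup>2 * w \<alpha> t (-a)) = ?I a - ?I (-a)"
      if a: "0 < a" "a < 1" for a
    proof -
      have "set_integrable lborel {-a..a} (\<lambda>x. poly (p * p) x * w (\<alpha> - 1) t x)"
        by (intro borel_integrable_atLeastAtMost' continuous_on_poly_weight_inside a)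
      hence int: "set_integrable lborel {-a..a} ?g"
        by (rule set_integrable_cong[THEN iffD1, OF refl refl, rotated])
           (use a in \<open>auto simp: w_minus_one power2_eq_square\<close>)
      have sub: "(\<lambda>x. poly ?q x * w \<alpha> t x) integrable_on {-a..a}"
        by (rule integrable_subinterval_real[OF qint]) (use a in auto)
      have F': "(?F' has_integral (?F a - ?F (-a))) {-a..a}"
        by (rule poly_weight_deriv_has_integral)
           (use a continuous_on_poly_weight_inside[of a s \<alpha> t] in auto)
      have "((\<lambda>x. 2 * \<alpha> * ?g x) has_integral
          (integral {-a..a} (\<lambda>x. poly ?q x * w \<alpha> t x) - (?F a - ?F (-a)))) {-a..a}"
        by (rule has_integral_eq[OF pw has_integral_diff[OF integrable_integral[OF sub] F']])
           (use a in auto)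
      hence "integral {-a..a} (\<lambda>x. 2 * \<alpha> * ?g x) =
          integral {-a..a} (\<lambda>x. poly ?q x * w \<alpha> t x) - (?F a - ?F (-a))"
        by (rule integral_unique)
      moreover have "?I (-a) + integral {-a..a} (\<lambda>x. poly ?q x * w \<alpha> t x) = ?I a"
        by (rule Henstock_Kurzweil_Integration.integral_combine)
           (use a integrable_subinterval_real[OF qint] in auto)
      moreover have "integral {-a..a} (\<lambda>x. 2 * \<alpha> * ?g x) = 2 * \<alpha> * (LINT y:{-a..a}|lborel. ?g y)"
        by (simp only: integral_mult_right set_borel_integral_eq_integral(2)[OF int])
      ultimately show ?thesis
        by (simp add: s_def power2_eq_square algebra_simps)
    qed
    have contI: "continuous_on {-1..1} ?I"
      by (rule indefinite_integral_continuous_1[OF qint])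
    have "((\<lambda>a. ?I a - ?I (-a)) \<longlongrightarrow> ?I 1 - ?I (-1)) (at 1 within {-1..1})"
    proof -
      have "continuous_on {-1..1} (\<lambda>a. ?I a - ?I (-a))"
        by (intro continuous_on_diff contI continuous_on_compose2[OF contI] continuous_intros) auto
      thus ?thesis unfolding continuous_on_def by (rule bspec) simp
    qed
    hence "((\<lambda>a. ?I a - ?I (-a)) \<longlongrightarrow> wint \<alpha> t ?q) (at_left 1)"
      using integral_unique[OF wint_has_integral[OF assms, of ?q t]]
      by (simp add: at_within_Icc_at_left)
    moreover have "eventually (\<lambda>a. 2 * \<alpha> * (LINT y:{-a..a}|lborel. ?g y)
        + (a * (poly p a)\<^sup>2 * w \<alpha> t a - (-a) * (poly p (-a))\<^sup>2 * w \<alpha> t (-a))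
        = ?I a - ?I (-a)) (at_left 1)"
      using eventually_at_left_real[of 0 1] by (rule eventually_mono) (use ev in auto)
    ultimately have "((\<lambda>a. 2 * \<alpha> * (LINT y:{-a..a}|lborel. ?g y)
        + (a * (poly p a)\<^sup>2 * w \<alpha> t a - (-a) * (poly p (-a))\<^sup>2 * w \<alpha> t (-a)))
        \<longlongrightarrow> wint \<alpha> t ?q) (at_left 1)"
      using tendsto_cong by fastforce
    hence "Lim (at_left 1) (\<lambda>a. 2 * \<alpha> * (LINT y:{-a..a}|lborel. ?g y)
        + (a * (poly p a)\<^sup>2 * w \<alpha> t a - (-a) * (poly p (-a))\<^sup>2 * w \<alpha> t (-a))) = wint \<alpha> t ?q"
      by (intro tendsto_Lim) simp_all
    thus ?thesis using False by (simp only: sing_integral_def if_False)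
  qed
qed

lemma exp_remainder_bound:
  fixes u :: real
  assumes "\<bar>u\<bar> \<le> 1"
  shows "\<bar>exp u - 1 - u\<bar> \<le> u\<^sup>2"
proof -
  have "exp u \<ge> 1 + u" by simp
  moreover have "exp u \<le> 1 + u + u\<^sup>2"
  proof (cases "u \<ge> 0")
    case True thus ?thesis using assms by (simp add: exp_bound)
  next
    case False
    \<comment> \<open>The product is $1 - u^3$.\<close>
    have "1 \<le> (1 + u + u\<^sup>2) * (1 - u)"
      using False by (simp add: power2_eq_square algebra_simps) (smt (verit) mult_neg_neg mult_less_0_iff)
    also have "\<dots> \<le> (1 + u + u\<^sup>2) * exp (-u)"
      using assms exp_ge_add_one_self[of "-u"] by (intro mult_left_mono) auto
    finally have "1 \<le> (1 + u + u\<^sup>2) * exp (-u)" .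
    thus ?thesis by (simp add: exp_minus field_simps)
  qed
  ultimately show ?thesis by linarith
qed

text \<open>Differentiation under the integral sign. As $x^2 \<le> 1$, the second-order remainder of
$e^{-(t+d)x^2}$ is at most $d^2 e^{-tx^2}$ for $|d| \<le> 1$, uniformly in $x$; the bound therefore
survives integration against the unbounded weights with $\<alpha> < 0$.\<close>
lemma DERIV_wint:
  assumes "\<alpha> > -1"
  shows "((\<lambda>t. wint \<alpha> t p) has_real_derivative - wint \<alpha> t ([:0, 0, 1:] * p)) (at t)"
proof -
  define C where "C = (LINT x:{-1..1}|lborel. \<bar>poly p x\<bar> * w \<alpha> t x)"
  have C0: "C \<ge> 0" unfolding C_def set_lebesgue_integral_def
    by (intro Bochner_Integration.integral_nonneg) (auto simp: w_def)
  have bound: "\<bar>wint \<alpha> (t + d) p - wint \<alpha> t p + d * wint \<alpha> t ([:0, 0, 1:] * p)\<bar> \<le> d\<^sup>2 * C"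
    if d: "\<bar>d\<bar> \<le> 1" for d
  proof -
    let ?e = "\<lambda>x. poly p x * w \<alpha> (t + d) x - poly p x * w \<alpha> t x + d * (poly ([:0, 0, 1:] * p) x * w \<alpha> t x)"
    note I = poly_weight_integrable[OF assms, of p "t + d"] poly_weight_integrable[OF assms, of p t]
      poly_weight_integrable[OF assms, of "[:0, 0, 1:] * p" t]
    have ie: "set_integrable lborel {-1..1} ?e"
      by (intro set_integral_add set_integral_diff set_integrable_mult_right I)
    have "wint \<alpha> (t + d) p - wint \<alpha> t p + d * wint \<alpha> t ([:0, 0, 1:] * p) = (LINT x:{-1..1}|lborel. ?e x)"
      unfolding wint_def using I
      by (subst set_integral_add(2), (intro set_integral_diff set_integrable_mult_right I)+)
         (simp add: set_integral_diff)
    moreover have "\<bar>LINT x:{-1..1}|lborel. ?e x\<bar> \<le> (LINT x:{-1..1}|lborel. \<bar>?e x\<bar>)"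
      using set_integral_norm_bound[OF ie] by simp
    moreover have "(LINT x:{-1..1}|lborel. \<bar>?e x\<bar>) \<le> (LINT x:{-1..1}|lborel. d\<^sup>2 * (\<bar>poly p x\<bar> * w \<alpha> t x))"
    proof (rule set_integral_mono)
      show "set_integrable lborel {-1..1} (\<lambda>x. \<bar>?e x\<bar>)"
        using set_integrable_norm[OF ie] by simp
      show "set_integrable lborel {-1..1} (\<lambda>x. d\<^sup>2 * (\<bar>poly p x\<bar> * w \<alpha> t x))"
        by (intro set_integrable_mult_right weight_integrable assms continuous_intros)
      fix x :: real assume x: "x \<in> {-1..1}"
      hence x2: "x\<^sup>2 \<le> 1" by (simp add: abs_square_le_1 abs_le_iff)
      have w: "w \<alpha> (t + d) x = w \<alpha> t x * exp (- d * x\<^sup>2)"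
        by (simp add: w_def exp_add[symmetric] algebra_simps)
      have "?e x = poly p x * w \<alpha> t x * (exp (- d * x\<^sup>2) - 1 - (- d * x\<^sup>2))"
        unfolding w by (simp add: algebra_simps power2_eq_square)
      moreover have "\<bar>exp (- d * x\<^sup>2) - 1 - (- d * x\<^sup>2)\<bar> \<le> d\<^sup>2"
      proof -
        have dx: "\<bar>- d * x\<^sup>2\<bar> \<le> \<bar>d\<bar>" using x2 by (simp add: abs_mult mult_left_le)
        hence "\<bar>exp (- d * x\<^sup>2) - 1 - (- d * x\<^sup>2)\<bar> \<le> (- d * x\<^sup>2)\<^sup>2"
          using d by (intro exp_remainder_bound) simp
        also have "\<dots> \<le> d\<^sup>2" using dx by (simp add: abs_le_square_iff)
        finally show ?thesis .
      qed
      ultimately have "\<bar>?e x\<bar> \<le> \<bar>poly p x * w \<alpha> t x\<bar> * d\<^sup>2"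
        by (simp add: abs_mult mult_left_mono)
      thus "\<bar>?e x\<bar> \<le> d\<^sup>2 * (\<bar>poly p x\<bar> * w \<alpha> t x)"
        by (simp add: abs_mult w_def mult_ac)
    qed
    ultimately show ?thesis by (simp add: C_def)
  qed
  show ?thesis
    unfolding DERIV_def
  proof (rule LIM_zero_cancel, rule tendsto_0_le[where K = 1])
    show "((\<lambda>d::real. \<bar>d\<bar> * C) \<longlongrightarrow> 0) (at 0)"
      by (auto intro!: tendsto_eq_intros)
    have "eventually (\<lambda>d::real. \<bar>d\<bar> \<le> 1 \<and> d \<noteq> 0) (at 0)"
      by (auto simp: eventually_at intro!: exI[of _ 1])
    thus "\<forall>\<^sub>F d in at 0. norm ((wint \<alpha> (t + d) p - wint \<alpha> t p) / d - - wint \<alpha> t ([:0, 0, 1:] * p))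
            \<le> norm (\<bar>d\<bar> * C) * 1"
    proof eventually_elim
      case (elim d)
      hence "(wint \<alpha> (t + d) p - wint \<alpha> t p) / d - - wint \<alpha> t ([:0, 0, 1:] * p) =
          (wint \<alpha> (t + d) p - wint \<alpha> t p + d * wint \<alpha> t ([:0, 0, 1:] * p)) / d"
        by (simp add: field_simps)
      also have "\<bar>\<dots>\<bar> \<le> d\<^sup>2 * C / \<bar>d\<bar>"
        using bound[of d] elim by (simp add: divide_right_mono)
      also have "\<dots> = \<bar>d\<bar> * C"
        using elim by (simp add: power2_eq_square field_simps abs_if)
      finally show ?case using C0 by simp
    qed
  qed
qed

section \<open>Orthogonal polynomials for an even functional\<close>

text \<open>The coefficient $\<beta>_n$ of the three-term recurrence $xP_n = P_{n+1} + \<beta>_n P_{n-1}$. The value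
$\<beta>_0 = 0$ makes the term with $P_{-1}$ disappear; the formulas below then hold for $n = 0$
whatever stands for the index $n - 1$.\<close>
definition recurrence_coeff :: "(nat \<Rightarrow> real) \<Rightarrow> nat \<Rightarrow> real" where
  "recurrence_coeff h n = (if n = 0 then 0 else h n / h (n - 1))"

lemma recurrence_coeff_0 [simp]: "recurrence_coeff h 0 = 0"
  by (simp add: recurrence_coeff_def)

lemma coeff_x_pderiv: "coeff ([:0, 1:] * pderiv p) k = of_nat k * coeff p k" for p :: "real poly"
  by (cases k) (simp_all add: coeff_pderiv)

locale even_orthogonal_polys =
  fixes L :: "real poly \<Rightarrow> real" and P :: "nat \<Rightarrow> real poly" and h :: "nat \<Rightarrow> real"
  assumes L_add: "L (p + q) = L p + L q"
    and L_smult: "L (smult c p) = c * L p"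
    and L_reflect: "L (pcompose p [:0, -1:]) = L p"
    and degree_P: "degree (P n) = n"
    and monic_P: "lead_coeff (P n) = 1"
    and ortho: "L (P m * P n) = (if m = n then h n else 0)"
    and h_nz: "h n \<noteq> 0"
begin

lemma L_0: "L 0 = 0" using L_smult[of 0 0] by simp

lemma L_minus: "L (- p) = - L p" using L_smult[of "-1" p] by simp

lemma L_diff: "L (p - q) = L p - L q" using L_add[of p "-q"] by (simp add: L_minus)

lemma coeff_P_self: "coeff (P n) n = 1" using monic_P[of n] by (simp add: degree_P)

lemma coeff_P_above: "k > n \<Longrightarrow> coeff (P n) k = 0" by (simp add: coeff_eq_0 degree_P)

lemma degree_reduce:
  assumes "degree q \<le> n"
  shows "q - smult (coeff q n) (P n) = 0 \<or> degree (q - smult (coeff q n) (P n)) < n"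
proof -
  let ?r = "q - smult (coeff q n) (P n)"
  have "degree ?r \<le> n"
    using assms by (intro degree_diff_le) (auto simp: degree_P)
  moreover have "coeff ?r n = 0" by (simp add: coeff_P_self)
  ultimately show ?thesis
    by (metis leading_coeff_0_iff le_neq_implies_less)
qed

lemma L_low_degree: "degree q < n \<Longrightarrow> L (q * P n) = 0"
proof (induction "degree q" arbitrary: q rule: less_induct)
  case less
  let ?d = "degree q" and ?r = "q - smult (coeff q (degree q)) (P (degree q))"
  have "L (?r * P n) = 0"
    using degree_reduce[of q ?d] less.hyps[of ?r] less.prems by (auto simp: L_0)
  moreover have "L (q * P n) = L (?r * P n) + coeff q ?d * L (P ?d * P n)"
    by (simp add: L_add[symmetric] L_smult[symmetric] left_diff_distrib)
  ultimately show ?case using ortho[of ?d n] less.prems by simp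
qed

lemma L_top_degree:
  assumes "degree q \<le> n"
  shows "L (q * P n) = coeff q n * h n"
proof -
  let ?r = "q - smult (coeff q n) (P n)"
  have "L (?r * P n) = 0"
    using degree_reduce[OF assms] L_low_degree[of ?r n] by (auto simp: L_0)
  moreover have "L (q * P n) = L (?r * P n) + coeff q n * L (P n * P n)"
    by (simp add: L_add[symmetric] L_smult[symmetric] left_diff_distrib)
  ultimately show ?thesis by (simp add: ortho)
qed

lemma L_determines:
  assumes "degree q < n" and "\<And>k. k < n \<Longrightarrow> L (q * P k) = 0"
  shows "q = 0"
proof (rule ccontr)
  assume "q \<noteq> 0"
  moreover have "coeff q (degree q) * h (degree q) = 0"
    using L_top_degree[of q "degree q"] assms by simp
  ultimately show False by (simp add: h_nz)
qed

text \<open>Two monic candidates differ by a polynomial of lower degree that is orthogonal to all lower $P_k$,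
hence zero.\<close>
lemma P_unique:
  assumes "degree q = n" "lead_coeff q = 1" and "\<And>k. k < n \<Longrightarrow> L (q * P k) = 0"
  shows "q = P n"
proof (cases "n = 0")
  case True
  thus ?thesis using assms degree_P[of 0] monic_P[of 0]
    by (metis degree_eq_zeroE lead_coeff_pCons(2) )
next
  case False
  have "q - P n = 0 \<or> degree (q - P n) < n"
    using degree_reduce[of q n] assms by auto
  moreover have "L ((q - P n) * P k) = 0" if "k < n" for k
    using that assms(3)[of k] ortho[of n k] by (simp add: left_diff_distrib L_diff)
  ultimately have "q - P n = 0" using L_determines[of "q - P n" n] by blast
  thus ?thesis by simp
qed

text \<open>The reflected polynomial $(-1)^n P_n(-x)$ is again monic and orthogonal to everything of lower degree.\<close>
lemma P_reflect: "pcompose (P n) [:0, -1:] = smult ((-1) ^ n) (P n)"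
proof -
  let ?refl = "\<lambda>p. pcompose p [:0, -1:]"
  have refl2: "?refl (?refl p) = p" for p :: "real poly"
    by (simp add: pcompose_assoc[symmetric] pcompose_pCons)
  have deg: "degree (?refl p) = degree p" for p :: "real poly"
    by (simp add: degree_pcompose)
  have "smult ((-1) ^ n) (?refl (P n)) = P n"
  proof (rule P_unique)
    show "degree (smult ((-1) ^ n) (?refl (P n))) = n" by (simp add: deg degree_P)
    show "lead_coeff (smult ((-1) ^ n) (?refl (P n))) = 1"
      by (simp add: lead_coeff_comp degree_P coeff_P_self mult.left_commute power_mult_distrib[symmetric])
    fix k assume "k < n"
    have "?refl (?refl (P n) * P k) = ?refl (P k) * P n"
      by (simp add: pcompose_mult refl2 mult.commute)
    hence "L (?refl (P n) * P k) = L (?refl (P k) * P n)"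
      using L_reflect[of "?refl (P n) * P k"] by simp
    also have "\<dots> = 0" using \<open>k < n\<close> by (intro L_low_degree) (simp add: deg degree_P)
    finally show "L (smult ((-1) ^ n) (?refl (P n)) * P k) = 0" by (simp add: L_smult)
  qed
  hence "smult ((-1) ^ n) (smult ((-1) ^ n) (?refl (P n))) = smult ((-1) ^ n) (P n)" by simp
  thus ?thesis by (simp add: power_mult_distrib[symmetric])
qed

lemma L_x: "L ([:0, 1:] * P n * P n) = 0"
proof -
  let ?refl = "\<lambda>p. pcompose p [:0, -1:]"
  have "?refl ([:0, 1:] * P n * P n) = - ([:0, 1:] * P n * P n)"
    by (simp add: pcompose_mult pcompose_pCons P_reflect power_mult_distrib[symmetric])
  hence "L ([:0, 1:] * P n * P n) = - L ([:0, 1:] * P n * P n)"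
    using L_reflect[of "[:0, 1:] * P n * P n"] L_minus[of "[:0, 1:] * P n * P n"] by metis
  thus ?thesis by linarith
qed

abbreviation \<beta> :: "nat \<Rightarrow> real" where
  "\<beta> \<equiv> recurrence_coeff h"

lemma h_Suc: "h (Suc n) = \<beta> (Suc n) * h n" by (simp add: recurrence_coeff_def h_nz)

lemma recurrence_coeff_mult_h: "\<beta> n * (\<beta> n * h (n - 1)) = \<beta> n * h n" by (simp add: recurrence_coeff_def h_nz)

lemma L_cross: "L ([:0, 1:] * P (Suc n) * P n) = h (Suc n)"
proof -
  have "L (([:0, 1:] * P n) * P (Suc n)) = h (Suc n)"
    using L_top_degree[of "[:0, 1:] * P n" "Suc n"] by (simp add: degree_P coeff_P_self degree_pCons_eq_if)
  thus ?thesis by (simp add: mult_ac)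
qed

lemma P_0: "P 0 = 1"
  using degree_P[of 0] monic_P[of 0] by (metis degree_eq_zeroE lead_coeff_pCons(2) one_pCons)

text \<open>The right candidate for $P_{n+1}$ is $xP_n - \<beta>_n P_{n-1}$: against $P_k$ with $k < n - 1$ it vanishes for
reasons of degree, against $P_{n-1}$ by the choice of $\<beta>_n$, and against $P_n$ by parity.\<close>
lemma recurrence: "[:0, 1:] * P n = P (Suc n) + smult (\<beta> n) (P (n - 1))"
proof -
  have deg: "degree (smult (\<beta> n) (P (n - 1))) < Suc n"
    by (rule le_less_trans[OF degree_smult_le]) (simp add: degree_P)
  have degx: "degree ([:0, 1:] * P n) = Suc n"
    using monic_P[of n] by (auto simp: degree_P degree_pCons_eq_if)
  have degq: "degree ([:0, 1:] * P n - smult (\<beta> n) (P (n - 1))) = Suc n"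
    using deg degx degree_add_eq_left[of "- smult (\<beta> n) (P (n - 1))" "[:0, 1:] * P n"] by simp
  have "[:0, 1:] * P n - smult (\<beta> n) (P (n - 1)) = P (Suc n)"
  proof (rule P_unique[OF degq])
    show "lead_coeff ([:0, 1:] * P n - smult (\<beta> n) (P (n - 1))) = 1"
      unfolding degq using deg by (simp add: coeff_P_self coeff_P_above)
    fix k assume k: "k < Suc n"
    have e: "L (([:0, 1:] * P n - smult (\<beta> n) (P (n - 1))) * P k) =
        L (([:0, 1:] * P k) * P n) - \<beta> n * L (P (n - 1) * P k)"
      unfolding left_diff_distrib mult_smult_left L_diff L_smult by (simp add: mult_ac)
    consider "k = n" | "Suc k = n" | "Suc k < n" using k by linarith
    thus "L (([:0, 1:] * P n - smult (\<beta> n) (P (n - 1))) * P k) = 0"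
    proof cases
      case 1
      thus ?thesis unfolding e using L_x[of n] ortho[of "n - 1" n] by (cases n) simp_all
    next
      case 2
      thus ?thesis unfolding e using L_cross[of k] ortho[of k k] h_Suc[of k]
        by (auto simp: mult_ac)
    next
      case 3
      hence "L (([:0, 1:] * P k) * P n) = 0"
        by (intro L_low_degree) (simp add: degree_P degree_pCons_eq_if)
      thus ?thesis unfolding e using 3 ortho[of "n - 1" k] by auto
    qed
  qed
  thus ?thesis by (simp add: algebra_simps)
qed

lemma L_x2: "L ([:0, 0, 1:] * (P n * P n)) = (\<beta> n + \<beta> (Suc n)) * h n"
proof -
  have "[:0, 0, 1:] * (P n * P n) = ([:0, 1:] * P n) * ([:0, 1:] * P n)"
    by simp
  also have "\<dots> = P (Suc n) * P (Suc n) + smult (\<beta> n) (P (n - 1) * P (Suc n))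
      + smult (\<beta> n) (P (n - 1) * P (Suc n))
      + smult (\<beta> n * \<beta> n) (P (n - 1) * P (n - 1))"
    unfolding recurrence
    by (simp add: algebra_simps)
  finally have "L ([:0, 0, 1:] * (P n * P n)) = h (Suc n) + \<beta> n * (\<beta> n * h (n - 1))"
    by (simp only: L_add L_smult ortho) simp
  thus ?thesis unfolding recurrence_coeff_mult_h h_Suc by (simp add: algebra_simps)
qed

lemma coeff_P_second: "coeff (P (Suc n)) n = 0"
proof (induction n)
  case 0
  have "P (Suc 0) = [:0, 1:] * P 0" using recurrence[of 0] by simp
  thus ?case by simp
next
  case (Suc n)
  have "coeff ([:0, 1:] * P (Suc n)) (Suc n) = coeff (P (Suc (Suc n)) + smult (\<beta> (Suc n)) (P n)) (Suc n)"
    using recurrence[of "Suc n"] by simp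
  thus ?case using Suc by (simp add: coeff_P_above)
qed

text \<open>The sums of recurrence coefficients that make up $H_n$ enter the theory as subleading coefficients.\<close>
lemma coeff_P_third: "coeff (P (Suc (Suc n))) n = - (\<Sum>j\<le>Suc n. \<beta> j)"
proof (induction n)
  case 0
  have "coeff ([:0, 1:] * P 1) 0 = coeff (P 2 + smult (\<beta> 1) (P 0)) 0"
    using recurrence[of 1] by (simp add: numeral_2_eq_2)
  thus ?case by (simp add: P_0 numeral_2_eq_2)
next
  case (Suc n)
  have "coeff ([:0, 1:] * P (Suc (Suc n))) (Suc n) =
      coeff (P (Suc (Suc (Suc n))) + smult (\<beta> (Suc (Suc n))) (P (Suc n))) (Suc n)"
    using recurrence[of "Suc (Suc n)"] by simp
  thus ?case using Suc by (simp add: coeff_P_self)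
qed

lemma L_euler: "L (([:0, 1:] * pderiv (P n)) * P n) = n * h n"
proof -
  have "degree ([:0, 1:] * pderiv (P n)) \<le> n"
    by (rule degree_le) (simp add: coeff_x_pderiv coeff_P_above del: mult_pCons_left)
  thus ?thesis using L_top_degree by (simp add: coeff_x_pderiv coeff_P_self del: mult_pCons_left)
qed

lemma L_deriv:
  "L (pderiv (P (Suc n)) * P n) = Suc n * h n"
  "L (pderiv (P n) * P (Suc n)) = 0"
proof -
  show "L (pderiv (P (Suc n)) * P n) = Suc n * h n"
    by (subst L_top_degree) (simp_all add: degree_pderiv degree_P coeff_pderiv coeff_P_self)
  show "L (pderiv (P n) * P (Suc n)) = 0"
    by (rule L_low_degree) (simp add: degree_pderiv degree_P)
qed

text \<open>In the second formula, the Euler operator $xP' - (n+1)P$ kills the leading term of $P = P_{n+1}$, so only the subleading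
coefficient of $P$ contributes besides $\<beta>$-terms from the recurrence.\<close>
lemma L_x2_deriv:
  "L ([:0, 0, 1:] * pderiv (P n) * P (Suc n)) = n * h (Suc n)"
  "L ([:0, 0, 1:] * pderiv (P (Suc n)) * P n) = Suc n * h (Suc n) + 2 * (\<Sum>j\<le>n. \<beta> j) * h n"
proof -
  have x2: "[:0, 0, 1:] * pderiv p = [:0, 1:] * ([:0, 1:] * pderiv p)" for p :: "real poly" by simp
  have c: "coeff ([:0, 1:] * p) (Suc k) = coeff p k" "coeff ([:0, 1:] * p) 0 = 0" for p :: "real poly" and k
    by simp_all
  have "degree ([:0, 0, 1:] * pderiv (P n)) \<le> Suc n"
    unfolding x2
  proof (rule degree_le, intro allI impI)
    fix k assume "k > Suc n"
    thus "coeff ([:0, 1:] * ([:0, 1:] * pderiv (P n))) k = 0"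
      by (cases k) (simp_all add: c coeff_x_pderiv coeff_P_above del: mult_pCons_left)
  qed
  thus "L ([:0, 0, 1:] * pderiv (P n) * P (Suc n)) = n * h (Suc n)"
    by (subst L_top_degree) (simp_all add: x2 c coeff_x_pderiv coeff_P_self del: mult_pCons_left)
  \<comment> \<open>The leading term of $D$ cancels and by parity the next one is zero.\<close>
  define D where "D = [:0, 1:] * pderiv (P (Suc n)) - smult (Suc n) (P (Suc n))"
  have coeffD: "coeff D k = (real k - real (Suc n)) * coeff (P (Suc n)) k" for k
    by (simp add: D_def coeff_x_pderiv left_diff_distrib del: mult_pCons_left)
  have "degree ([:0, 1:] * D) \<le> n"
  proof (rule degree_le, intro allI impI)
    fix k assume "k > n"
    then obtain l where l: "k = Suc l" "l \<ge> n" by (cases k) auto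
    consider "l = n" | "l = Suc n" | "l > Suc n" using l by linarith
    thus "coeff ([:0, 1:] * D) k = 0"
      by cases (simp_all add: l(1) c coeffD coeff_P_second coeff_P_above del: mult_pCons_left)
  qed
  moreover have "coeff ([:0, 1:] * D) n = 2 * (\<Sum>j\<le>n. \<beta> j)"
    by (cases n) (simp_all add: c coeffD coeff_P_third del: mult_pCons_left)
  ultimately have LD: "L (([:0, 1:] * D) * P n) = 2 * (\<Sum>j\<le>n. \<beta> j) * h n"
    by (subst L_top_degree) simp_all
  have "[:0, 0, 1:] * pderiv (P (Suc n)) * P n =
      ([:0, 1:] * D) * P n + smult (Suc n) ([:0, 1:] * P (Suc n) * P n)"
    unfolding x2 D_def by (simp add: algebra_simps)
  thus "L ([:0, 0, 1:] * pderiv (P (Suc n)) * P n) = Suc n * h (Suc n) + 2 * (\<Sum>j\<le>n. \<beta> j) * h n"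
    by (simp add: L_add L_smult LD L_cross del: mult_pCons_left)
qed

lemma L_x3:
  "L ([:0, 1:] * [:0, 0, 1:] * (P (Suc n) * P n)) = (\<beta> n + \<beta> (Suc n) + \<beta> (Suc (Suc n))) * h (Suc n)"
proof -
  have "[:0, 1:] * [:0, 0, 1:] * (P (Suc n) * P n) =
      [:0, 0, 1:] * (P (Suc n) * P (Suc n)) + smult (\<beta> n) (([:0, 1:] * P (Suc n)) * ([:0, 1:] * P (n - 1)))"
  proof -
    have "[:0, 1:] * [:0, 0, 1:] * (P (Suc n) * P n) = [:0, 0, 1:] * P (Suc n) * ([:0, 1:] * P n)"
      by (simp add: algebra_simps)
    also have "\<dots> = [:0, 0, 1:] * P (Suc n) * P (Suc n) + smult (\<beta> n) ([:0, 0, 1:] * P (Suc n) * P (n - 1))"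
      unfolding recurrence by (simp add: algebra_simps)
    finally show ?thesis by (simp add: algebra_simps)
  qed
  moreover have "\<beta> n * L (([:0, 1:] * P (Suc n)) * ([:0, 1:] * P (n - 1))) = \<beta> n * h (Suc n)"
  proof (cases n)
    case (Suc m)
    have "L (([:0, 1:] * P (Suc n)) * ([:0, 1:] * P m)) =
        L (P (Suc (Suc n)) * P n) + \<beta> m * L (P (Suc (Suc n)) * P (m - 1))
        + \<beta> (Suc n) * L (P n * P n) + \<beta> (Suc n) * \<beta> m * L (P n * P (m - 1))"
      unfolding recurrence by (simp add: Suc algebra_simps L_add L_smult)
    thus ?thesis using Suc by (simp add: ortho h_Suc)
  qed simp
  ultimately show ?thesis
    using L_x2[of "Suc n"] by (simp add: L_add L_smult distrib_right del: mult_pCons_left)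
qed

end

section \<open>The string equation\<close>

text \<open>The only further information about the weight is its Pearson equation in integrated form.\<close>
locale gauss_gegenbauer_polys = even_orthogonal_polys +
  fixes \<alpha> t :: real
  assumes pearson: "L ([:1, 0, -1:] * pderiv p - smult (2 * (\<alpha> + 1)) ([:0, 1:] * p)
            - smult (2 * t) ([:0, 1:] * [:1, 0, -1:] * p)) = 0"
begin

text \<open>The integrated Pearson identity for the polynomial $P_n P_{n-1}$, each of whose terms has been computed
above.\<close>
lemma string_equation:
  "(\<Sum>j<n. \<beta> j + \<beta> (Suc j)) =
     real n - \<beta> n * (2 * real n + 2 * \<alpha> + 2 * t) + 2 * t * \<beta> n * (\<beta> (n - 1) + \<beta> n + \<beta> (Suc n))"
proof (cases n)
  case (Suc m)
  let ?p = "P (Suc m)" and ?q = "P m" and ?x = "[:0, 1:]" and ?x2 = "[:0, 0, 1:]"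
  have one: "[:1, 0, -1:] = (1 - ?x2 :: real poly)" by (simp add: one_pCons)
  have "[:1, 0, -1:] * pderiv (?p * ?q) - smult (2 * (\<alpha> + 1)) (?x * (?p * ?q))
            - smult (2 * t) (?x * [:1, 0, -1:] * (?p * ?q)) =
        pderiv ?p * ?q + pderiv ?q * ?p - ?x2 * pderiv ?p * ?q - ?x2 * pderiv ?q * ?p
        - smult (2 * (\<alpha> + 1)) (?x * ?p * ?q) - smult (2 * t) (?x * ?p * ?q)
        + smult (2 * t) (?x * ?x2 * (?p * ?q))"
    unfolding one pderiv_mult
    by (simp only: left_diff_distrib right_diff_distrib smult_diff_right mult_1 distrib_left distrib_right) 
       (simp add: mult_ac del: mult_pCons_left mult_pCons_right)
  hence "Suc m * h m - (Suc m * h (Suc m) + 2 * (\<Sum>j\<le>m. \<beta> j) * h m) - m * h (Suc m)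
      - 2 * (\<alpha> + 1) * h (Suc m) - 2 * t * h (Suc m)
      + 2 * t * ((\<beta> m + \<beta> (Suc m) + \<beta> (Suc (Suc m))) * h (Suc m)) = 0"
    using pearson[of "?p * ?q"] by (simp only: L_add L_diff L_smult L_deriv L_x2_deriv L_cross L_x3)
  hence "h m * (Suc m - 2 * (\<Sum>j\<le>m. \<beta> j) - \<beta> (Suc m) * (2 * m + 2 * \<alpha> + 3 + 2 * t)
      + 2 * t * \<beta> (Suc m) * (\<beta> m + \<beta> (Suc m) + \<beta> (Suc (Suc m)))) = 0"
    unfolding h_Suc by (simp add: algebra_simps)
  hence "Suc m - 2 * (\<Sum>j\<le>m. \<beta> j) - \<beta> (Suc m) * (2 * m + 2 * \<alpha> + 3 + 2 * t)
      + 2 * t * \<beta> (Suc m) * (\<beta> m + \<beta> (Suc m) + \<beta> (Suc (Suc m))) = 0"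
    using h_nz[of m] by simp
  moreover have "(\<Sum>j<Suc m. \<beta> j + \<beta> (Suc j)) = 2 * (\<Sum>j\<le>m. \<beta> j) + \<beta> (Suc m)"
    by (induction m) simp_all
  ultimately show ?thesis unfolding Suc by (simp add: algebra_simps)
qed simp

text \<open>Up to constant factors, $r_n$ and $\<rho>_n$ are the residues of the ladder operators' coefficients at $\<plusminus>1$; $\<rho>_n$ is the
$R_n$ of the theorem, freed of the singular integral.\<close>
definition r :: "nat \<Rightarrow> real" where "r n = n - 2 * t * \<beta> n"

definition \<rho> :: "nat \<Rightarrow> real" where "\<rho> n = 2 * real n + 1 + 2 * \<alpha> - 2 * t * (\<beta> n + \<beta> (Suc n))"

text \<open>Increments of both sides in $n$ agree. On the left the increment factors as
$(r_{n+1} - r_n)\<rho>_n$ because $r_{n+1} + r_n + 2\<alpha> = \<rho>_n$; on the right it is $\<rho>_n$ times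
$\<beta>_{n+1}\<rho>_{n+1} - \<beta>_n\<rho>_{n-1}$. The two remaining factors agree by the difference of two consecutive
string equations. The string equation carries no common factor $t$, so $t = 0$ is covered as well.\<close>
lemma r_quadratic: "(r n)\<^sup>2 + 2 * \<alpha> * r n = \<beta> n * \<rho> n * \<rho> (n - 1)"
proof (induction n)
  case 0
  show ?case by (simp add: r_def)
next
  case (Suc n)
  \<comment> \<open>Reading $\<rho>_{-1}$ as $0$; for $n = 0$ its factor $\<beta>_0$ vanishes.\<close>
  define b where "b = (if n = 0 then 0 else \<rho> (n - 1))"
  have IH: "(r n)\<^sup>2 + 2 * \<alpha> * r n = \<beta> n * \<rho> n * b"
    using Suc.IH by (simp add: b_def)
  have step: "\<beta> (Suc n) * \<rho> (Suc n) - \<beta> n * b = r (Suc n) - r n"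
    using string_equation[of n] string_equation[of "Suc n"]
    by (cases n) (simp_all add: b_def r_def \<rho>_def algebra_simps)
  have \<rho>: "\<rho> n = r (Suc n) + r n + 2 * \<alpha>"
    by (simp add: r_def \<rho>_def algebra_simps)
  have "(r (Suc n))\<^sup>2 + 2 * \<alpha> * r (Suc n) - ((r n)\<^sup>2 + 2 * \<alpha> * r n) = (r (Suc n) - r n) * \<rho> n"
    unfolding \<rho> by (simp add: power2_eq_square algebra_simps)
  thus ?case unfolding step[symmetric] using IH by (simp add: algebra_simps)
qed

end

section \<open>Dependence on the deformation parameter\<close>

lemma wint_zero: "wint \<alpha> t 0 = 0"
  by (simp add: wint_def set_lebesgue_integral_def)

lemma wint_coeff_expansion:
  assumes "\<alpha> > -1" "degree q \<le> N"
  shows "wint \<alpha> t (p * q) = (\<Sum>k\<le>N. coeff q k * wint \<alpha> t (p * monom 1 k))"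
proof -
  have sum: "wint \<alpha> t (\<Sum>k\<in>A. f k) = (\<Sum>k\<in>A. wint \<alpha> t (f k))" for f :: "nat \<Rightarrow> real poly" and A
    by (induction A rule: infinite_finite_induct) (simp_all add: wint_zero wint_add assms(1))
  have "p * q = (\<Sum>k\<le>N. smult (coeff q k) (p * monom 1 k))"
    by (subst poly_as_sum_of_monoms'[OF assms(2), symmetric])
       (simp add: sum_distrib_left smult_monom flip: mult_smult_right)
  thus ?thesis by (simp add: sum wint_smult)
qed

locale gauss_gegenbauer_family =
  fixes \<alpha> :: real and P :: "nat \<Rightarrow> real \<Rightarrow> real poly" and h :: "nat \<Rightarrow> real \<Rightarrow> real"
  assumes alpha: "\<alpha> > -1"
    and monic_orthogonal: "monic_orthogonal (w \<alpha> t) (\<lambda>k. P k t) (\<lambda>k. h k t)"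
begin

lemma wint_P: "wint \<alpha> t (P m t * P n t) = (if m = n then h n t else 0)"
  using monic_orthogonal[of t] by (simp add: monic_orthogonal_def wint_def mult.assoc)

lemma polys_at: "gauss_gegenbauer_polys (wint \<alpha> t) (\<lambda>k. P k t) (\<lambda>k. h k t) \<alpha> t"
proof
  show "wint \<alpha> t (p + q) = wint \<alpha> t p + wint \<alpha> t q" for p q by (rule wint_add[OF alpha])
  show "wint \<alpha> t (smult c p) = c * wint \<alpha> t p" for c p by (rule wint_smult)
  show "wint \<alpha> t (p \<circ>\<^sub>p [:0, - 1:]) = wint \<alpha> t p" for p by (rule wint_reflect)
  show deg: "degree (P n t) = n" and lead: "lead_coeff (P n t) = 1" for n
    using monic_orthogonal[of t] unfolding monic_orthogonal_def by blast+
  show "wint \<alpha> t (P m t * P n t) = (if m = n then h n t else 0)" for m n by (rule wint_P)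
  show "h n t \<noteq> 0" for n
  proof -
    have "P n t \<noteq> 0" using lead[of n] by auto
    from wint_square_pos[OF alpha this, of t] show ?thesis by (simp add: wint_P)
  qed
qed (rule wint_pearson[OF alpha])

end

sublocale gauss_gegenbauer_family \<subseteq> fixed_t: gauss_gegenbauer_polys
  "wint \<alpha> t" "\<lambda>k. P k t" "\<lambda>k. h k t" \<alpha> t for t
  by (rule polys_at)

context gauss_gegenbauer_family
begin

abbreviation b :: "nat \<Rightarrow> real \<Rightarrow> real" where
  "b n t \<equiv> recurrence_coeff (\<lambda>k. h k t) n"

lemma R_eq: "R \<alpha> P h n t = 2 * real n + 1 + 2 * \<alpha> - 2 * t * (b n t + b (Suc n) t)"
proof -
  let ?p = "P n t"
  have "pderiv ([:0, 1:] * (?p * ?p)) = ?p * ?p + ([:0, 1:] * pderiv ?p) * ?p + ([:0, 1:] * pderiv ?p) * ?p"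
    by (simp add: pderiv_mult pderiv_pCons algebra_simps)
  hence "sing_integral \<alpha> t ?p = 2 * \<alpha> * h n t + (h n t + n * h n t + n * h n t)
      - 2 * t * ((b n t + b (Suc n) t) * h n t)"
    unfolding sing_integral_eq_wint[OF alpha]
    by (simp only: fixed_t.L_add fixed_t.L_diff fixed_t.L_smult fixed_t.L_x2 fixed_t.L_euler wint_P
        refl if_True)
  hence "sing_integral \<alpha> t ?p = (2 * real n + 1 + 2 * \<alpha> - 2 * t * (b n t + b (Suc n) t)) * h n t"
    by (simp add: algebra_simps)
  thus ?thesis using fixed_t.h_nz[of n t] by (simp add: R_def)
qed

lemma H_eq: "H \<alpha> P h n t = (real n)\<^sup>2 + 2 * n * \<alpha> - 2 * t * (\<Sum>j<n. b j t + b (Suc j) t)"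
  unfolding H_def R_eq by (induction n) (simp_all add: power2_eq_square algebra_simps)

text \<open>Both $h_n(s)$ and $h_n(t)$ are integrals of the same polynomial $P_n(x,t)P_n(x,s)$, against the weights at
$s$ and at $t$. Hence the difference quotient of $h_n$ is a combination of difference quotients of
moments, and continuity of the coefficients is enough to pass to the limit.\<close>
lemma DERIV_h_if_continuous:
  assumes cont: "\<And>k. isCont (\<lambda>s. coeff (P n s) k) t"
  shows "(h n has_real_derivative - (b n t + b (Suc n) t) * h n t) (at t)"
proof -
  have "\<exists>g. (\<forall>s. wint \<alpha> s (monom 1 k) - wint \<alpha> t (monom 1 k) = g s * (s - t)) \<and> isCont g t
          \<and> g t = - wint \<alpha> t ([:0, 0, 1:] * monom 1 k)" for k
    using DERIV_wint[OF alpha, of "monom 1 k" t] by (simp only: CARAT_DERIV)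
  then obtain g where g: "\<And>k s. wint \<alpha> s (monom 1 k) - wint \<alpha> t (monom 1 k) = g k s * (s - t)"
    and gc: "\<And>k. isCont (g k) t" and gt: "\<And>k. g k t = - wint \<alpha> t ([:0, 0, 1:] * monom 1 k)"
    by metis
  \<comment> \<open>Caratheodory form of the derivative: $G$ is the difference quotient, continuous at $t$.\<close>
  define G where "G s = (\<Sum>k\<le>2 * n. coeff (P n t * P n s) k * g k s)" for s
  have deg: "degree (P n t * P n s) \<le> 2 * n" for s
    using degree_mult_le[of "P n t" "P n s"] by (simp add: fixed_t.degree_P)
  have "h n s - h n t = G s * (s - t)" for s
  proof -
    \<comment> \<open>Orthogonality at $s$ sees only the leading term of $P_n(x,t)$, and conversely.\<close>
    have "h n s = wint \<alpha> s (P n t * P n s)"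
      using fixed_t.L_top_degree[of "P n t" n s] by (simp add: fixed_t.degree_P fixed_t.coeff_P_self)
    moreover have "h n t = wint \<alpha> t (P n t * P n s)"
      using fixed_t.L_top_degree[of "P n s" n t] by (simp add: fixed_t.degree_P fixed_t.coeff_P_self mult.commute)
    ultimately have "h n s - h n t = (\<Sum>k\<le>2 * n. coeff (P n t * P n s) k * (wint \<alpha> s (monom 1 k) - wint \<alpha> t (monom 1 k)))"
      using wint_coeff_expansion[OF alpha deg[of s], of _ 1] by (simp add: sum_subtractf algebra_simps)
    thus ?thesis by (simp add: g G_def sum_distrib_right mult.assoc)
  qed
  moreover have "isCont G t"
    unfolding G_def coeff_mult by (intro continuous_intros cont gc)
  moreover have "G t = - wint \<alpha> t ([:0, 0, 1:] * (P n t * P n t))"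
    using wint_coeff_expansion[OF alpha deg[of t], of t "[:0, 0, 1:]"]
    by (simp add: G_def gt sum_negf del: mult_pCons_left)
  hence "G t = - (b n t + b (Suc n) t) * h n t"
    by (simp only: fixed_t.L_x2 minus_mult_left)
  ultimately show ?thesis by (auto simp: CARAT_DERIV)
qed

text \<open>The recurrence expresses $P_n$ through the lower polynomials and $h_{n-1}/h_{n-2}$, whose continuity follows
from that of lower coefficients by the preceding lemma.\<close>
lemma coeff_P_continuous: "isCont (\<lambda>s. coeff (P n s) k) t"
proof (induction n arbitrary: k rule: less_induct)
  case (less n)
  show ?case
  proof (cases n)
    case 0
    thus ?thesis by (simp add: fixed_t.P_0)
  next
    case (Suc m)
    have hc: "isCont (h j) t" if "j < n" for j
      using DERIV_isCont[OF DERIV_h_if_continuous] less.IH[OF that] by blast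
    have bc: "isCont (b m) t"
    proof (cases "m = 0")
      case False
      thus ?thesis unfolding recurrence_coeff_def
        using Suc by (simp, intro continuous_divide hc fixed_t.h_nz) auto
    qed simp
    have "coeff (P n s) k = coeff ([:0, 1:] * P m s) k - b m s * coeff (P (m - 1) s) k" for s
      unfolding Suc fixed_t.recurrence by simp
    moreover have "isCont (\<lambda>s. coeff ([:0, 1:] * P m s) k) t"
      using less.IH[of m] Suc by (cases k) simp_all
    moreover have "isCont (\<lambda>s. coeff (P (m - 1) s) k) t"
      using less.IH[of "m - 1"] Suc by simp
    ultimately show ?thesis using bc by (simp del: mult_pCons_left)
  qed
qed

lemma DERIV_h: "(h n has_real_derivative - (b n t + b (Suc n) t) * h n t) (at t)"
  by (rule DERIV_h_if_continuous[OF coeff_P_continuous])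

text \<open>The Volterra (Toda-type) lattice equation, the logarithmic derivative of $h_n / h_{n-1}$.\<close>
lemma DERIV_b: "(b n has_real_derivative b n t * (b (n - 1) t - b (Suc n) t)) (at t)"
proof (cases n)
  case (Suc m)
  have "((\<lambda>t. h (Suc m) t / h m t) has_real_derivative
     ((- (b (Suc m) t + b (Suc (Suc m)) t) * h (Suc m) t) * h m t
       - h (Suc m) t * (- (b m t + b (Suc m) t) * h m t)) / (h m t * h m t)) (at t)"
    by (rule DERIV_divide[OF DERIV_h DERIV_h fixed_t.h_nz])
  also have "((- (b (Suc m) t + b (Suc (Suc m)) t) * h (Suc m) t) * h m t
       - h (Suc m) t * (- (b m t + b (Suc m) t) * h m t)) / (h m t * h m t)
      = h (Suc m) t / h m t * (b m t - b (Suc (Suc m)) t)"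
    using fixed_t.h_nz[of m t] by (simp add: field_simps)
  finally show ?thesis by (simp add: Suc recurrence_coeff_def)
qed simp

lemma DERIV_sum_b:
  "((\<lambda>t. \<Sum>j<n. b j t + b (Suc j) t) has_real_derivative - (b n t * (b (n - 1) t + b (Suc n) t))) (at t)"
proof (induction n)
  case (Suc n)
  have "((\<lambda>t. (\<Sum>j<n. b j t + b (Suc j) t) + (b n t + b (Suc n) t)) has_real_derivative
     - (b n t * (b (n - 1) t + b (Suc n) t)) + (b n t * (b (n - 1) t - b (Suc n) t)
        + b (Suc n) t * (b (Suc n - 1) t - b (Suc (Suc n)) t))) (at t)"
    by (intro DERIV_add Suc DERIV_b)
  thus ?case by (simp add: algebra_simps)
qed simp

definition H_deriv :: "nat \<Rightarrow> real \<Rightarrow> real" where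
  "H_deriv n t = - 2 * (\<Sum>j<n. b j t + b (Suc j) t) + 2 * t * b n t * (b (n - 1) t + b (Suc n) t)"

lemma DERIV_H: "(H \<alpha> P h n has_real_derivative H_deriv n t) (at t)"
  unfolding H_eq[abs_def]
  using DERIV_diff[OF DERIV_const[of "(real n)\<^sup>2 + 2 * n * \<alpha>"]
      DERIV_mult[OF DERIV_cmult_Id[of 2 t UNIV] DERIV_sum_b[of n t]]]
  by (simp add: H_deriv_def algebra_simps)

lemma H_deriv_differentiable: "\<exists>H2. \<forall>t. (H_deriv n has_real_derivative H2 t) (at t)"
proof -
  have "\<exists>D. (H_deriv n has_real_derivative D) (at t)" for t
    unfolding H_deriv_def[abs_def]
    by (rule exI, (rule derivative_intros DERIV_sum_b DERIV_b)+)
  thus ?thesis by metis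
qed

text \<open>After $H_n$ and $H_n'$ are written in the $\<beta>$'s, this is $2t$ times the string equation. It makes
$Q = r + t + \<alpha>$ a square root of $H - 2tH' + (t+\<alpha>)^2$.\<close>
lemma r_completed_square:
  "(fixed_t.r t n)\<^sup>2 + 2 * (t + \<alpha>) * fixed_t.r t n = H \<alpha> P h n t - 2 * t * H_deriv n t"
  unfolding H_eq H_deriv_def fixed_t.string_equation fixed_t.r_def
  by (simp add: power2_eq_square algebra_simps)

lemma r_quadratic_explicit:
  "(fixed_t.r t n)\<^sup>2 + 2 * \<alpha> * fixed_t.r t n =
     b n t * (2 * real n + 1 + 2 * \<alpha> - 2 * t * (b n t + b (Suc n) t))
           * (2 * real n - 1 + 2 * \<alpha> - 2 * t * (b (n - 1) t + b n t))"
  using fixed_t.r_quadratic[where n=n and t=t] by (cases n) (simp_all add: fixed_t.\<rho>_def)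

lemma DERIV_r:
  "((\<lambda>t. fixed_t.r t n) has_real_derivative
     - 2 * b n t - 2 * t * (b n t * (b (n - 1) t - b (Suc n) t))) (at t)"
  unfolding fixed_t.r_def
  using DERIV_diff[OF DERIV_const[of "real n"]
      DERIV_mult[OF DERIV_cmult_Id[of 2 t UNIV] DERIV_b[of n t]]]
  by (simp add: algebra_simps)

text \<open>By the lattice equation $r' = -\<beta>_n(\<rho>_n - \<rho>_{n-1})$, and by the string equation
$H' + 2r = \<beta>_n(\<rho>_n + \<rho>_{n-1})$. The difference of their squares is governed by the product
$\<beta>_n\<rho>_n\<rho>_{n-1} = r^2 + 2\<alpha>r$, which eliminates both $\<rho>$'s, while $r'$ itself is expressed in $H''$
by differentiating the completed square. The common factor $t$ stays, so that the equation holds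
at $t = 0$ too.\<close>
lemma r_first_order:
  assumes "(H_deriv n has_real_derivative H2) (at t)"
  defines "r \<equiv> fixed_t.r t n"
  shows "t * (2 * t * H2 + H_deriv n t + 2 * r)\<^sup>2 =
     (r + (t + \<alpha>))\<^sup>2 * (4 * t * (H_deriv n t + 2 * r)\<^sup>2 - 8 * (n - r) * (r\<^sup>2 + 2 * \<alpha> * r))"
proof -
  define \<beta> \<beta>p \<beta>m where "\<beta> = b n t" and "\<beta>p = b (Suc n) t" and "\<beta>m = b (n - 1) t"
  define r' where "r' = - 2 * \<beta> - 2 * t * (\<beta> * (\<beta>m - \<beta>p))"
  define \<rho>p \<rho>m where "\<rho>p = 2 * real n + 1 + 2 * \<alpha> - 2 * t * (\<beta> + \<beta>p)"
    and "\<rho>m = 2 * real n - 1 + 2 * \<alpha> - 2 * t * (\<beta>m + \<beta>)"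
  have r: "n - r = 2 * t * \<beta>" by (simp add: r_def fixed_t.r_def \<beta>_def)
  have r': "((\<lambda>t. fixed_t.r t n) has_real_derivative r') (at t)"
    using DERIV_r[of n t] by (simp add: r'_def \<beta>_def \<beta>p_def \<beta>m_def)
  have "((\<lambda>t. (fixed_t.r t n)\<^sup>2 + 2 * (t + \<alpha>) * fixed_t.r t n) has_real_derivative
      2 * r * r' + 2 * r + 2 * (t + \<alpha>) * r') (at t)"
    by (auto intro!: derivative_eq_intros r' simp: r_def algebra_simps)
  moreover have "((\<lambda>t. H \<alpha> P h n t - 2 * t * H_deriv n t) has_real_derivative
      - H_deriv n t - 2 * t * H2) (at t)"
    by (auto intro!: derivative_eq_intros DERIV_H assms(1) simp: algebra_simps)
  ultimately have "2 * r * r' + 2 * r + 2 * (t + \<alpha>) * r' = - H_deriv n t - 2 * t * H2"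
    unfolding r_completed_square by (rule DERIV_unique)
  hence d: "2 * t * H2 + H_deriv n t + 2 * r = - 2 * (r + (t + \<alpha>)) * r'"
    by (simp add: algebra_simps)
  have diff: "r' = - \<beta> * (\<rho>p - \<rho>m)"
    by (simp add: r'_def \<rho>p_def \<rho>m_def algebra_simps)
  have sum: "H_deriv n t + 2 * r = \<beta> * (\<rho>p + \<rho>m)"
    unfolding H_deriv_def fixed_t.string_equation r_def fixed_t.r_def \<rho>p_def \<rho>m_def \<beta>_def \<beta>p_def \<beta>m_def
    by (simp add: algebra_simps)
  have quad: "r\<^sup>2 + 2 * \<alpha> * r = \<beta> * \<rho>p * \<rho>m"
    using r_quadratic_explicit[where n=n and t=t] by (simp add: r_def \<rho>p_def \<rho>m_def \<beta>_def \<beta>p_def \<beta>m_def)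
  show ?thesis unfolding d sum quad r diff by algebra
qed

end

section \<open>The differential equation\<close>

text \<open>Given $Q^2$ as an affine function of $H$ and $H'$, the first-order equation for $r$ takes the form
$A + 4QB = 0$ with $A$ and $B$ free of $Q$. Squaring $A = -4QB$ eliminates the square root $Q$; this
is why the equation for $H$ has the form of a square equal to another square times $Q^2$.\<close>
lemma quartic_resolvent:
  fixes H0 H1 H2 Q n t \<alpha> :: real
  defines "r \<equiv> Q - (t + \<alpha>)"
  assumes Q: "Q\<^sup>2 = H0 - 2 * t * H1 + (t + \<alpha>)\<^sup>2"
    and E: "t * (2 * t * H2 + H1 + 2 * r)\<^sup>2 =
        Q\<^sup>2 * (4 * t * (H1 + 2 * r)\<^sup>2 - 8 * (n - r) * (r\<^sup>2 + 2 * \<alpha> * r))"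
  shows "(4 * t^3 * H2^2 + 4 * t^2 * H2 * (H1 - 2 * (t + \<alpha>)) + 8 * t^2 * H1^3
        - t * H1^2 * (4 * H0 + 4 * (t + \<alpha>)^2 - 32 * n * t - 1)
        - 4 * t * H1 * (4 * (2 * n + \<alpha> + t) * H0
            + (3 * t + \<alpha>) * (4 * n * t + 4 * n * \<alpha> + 1))
        + 8 * (n + \<alpha> + t) * H0^2
        + 4 * H0 * (2 * t^3 + 6 * t^2 * (n + \<alpha>)
            + t * (8 * n * \<alpha> + 6 * \<alpha>^2 + 1) + 2 * \<alpha>^2 * (n + \<alpha>))
        + 8 * t * (t + \<alpha>)^2 * (2 * n * (t + \<alpha>) + 1))^2
      = 16 * (H0 - 2 * t * H1 + (t + \<alpha>)^2)
        * (2 * t^2 * H2 + t * (4 * H0 + 8 * n * t + 1) * H1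
            - 2 * H0^2
            - 2 * H0 * (2 * n * t + (t + \<alpha>)^2)
            - 2 * t * (t + \<alpha>) * (2 * n * (t + \<alpha>) + 1))^2" (is "?A\<^sup>2 = 16 * ?X * ?B\<^sup>2")
proof -
  have H0: "H0 = Q\<^sup>2 + 2 * t * H1 - (t + \<alpha>)\<^sup>2" using Q by simp
  \<comment> \<open>The terms of the first-order equation that are even in $Q$ form $A$, the odd ones $4QB$.\<close>
  have "?A + 4 * Q * ?B = t * (2 * t * H2 + H1 + 2 * r)\<^sup>2 -
        Q\<^sup>2 * (4 * t * (H1 + 2 * r)\<^sup>2 - 8 * (n - r) * (r\<^sup>2 + 2 * \<alpha> * r))"
    unfolding H0 r_def by algebra
  hence "?A = - (4 * Q * ?B)" using E by simp
  hence "?A\<^sup>2 = 16 * Q\<^sup>2 * ?B\<^sup>2" by (simp add: power_mult_distrib)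
  thus ?thesis by (simp only: Q)
qed

theorem theorem5p1:
  fixes \<alpha> :: real and P :: "nat \<Rightarrow> real \<Rightarrow> real poly" and h :: "nat \<Rightarrow> real \<Rightarrow> real"
    and n :: nat
  assumes alpha: "\<alpha> > -1"
    and P: "\<And>t. monic_orthogonal (w \<alpha> t) (\<lambda>k. P k t) (\<lambda>k. h k t)"
  shows "\<exists>H' H'' :: real \<Rightarrow> real.
    (\<forall>t. (H \<alpha> P h n has_real_derivative H' t) (at t)) \<and>
    (\<forall>t. (H' has_real_derivative H'' t) (at t)) \<and>
    (\<forall>t.
      (4 * t^3 * (H'' t)^2 + 4 * t^2 * H'' t * (H' t - 2 * (t + \<alpha>)) + 8 * t^2 * (H' t)^3
        - t * (H' t)^2 * (4 * H \<alpha> P h n t + 4 * (t + \<alpha>)^2 - 32 * real n * t - 1)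
        - 4 * t * H' t * (4 * (2 * real n + \<alpha> + t) * H \<alpha> P h n t
            + (3 * t + \<alpha>) * (4 * real n * t + 4 * real n * \<alpha> + 1))
        + 8 * (real n + \<alpha> + t) * (H \<alpha> P h n t)^2
        + 4 * H \<alpha> P h n t * (2 * t^3 + 6 * t^2 * (real n + \<alpha>)
            + t * (8 * real n * \<alpha> + 6 * \<alpha>^2 + 1) + 2 * \<alpha>^2 * (real n + \<alpha>))
        + 8 * t * (t + \<alpha>)^2 * (2 * real n * (t + \<alpha>) + 1))^2
      = 16 * (H \<alpha> P h n t - 2 * t * H' t + (t + \<alpha>)^2)
        * (2 * t^2 * H'' t + t * (4 * H \<alpha> P h n t + 8 * real n * t + 1) * H' t
            - 2 * (H \<alpha> P h n t)^2
            - 2 * H \<alpha> P h n t * (2 * real n * t + (t + \<alpha>)^2)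
            - 2 * t * (t + \<alpha>) * (2 * real n * (t + \<alpha>) + 1))^2) \<and>
    H \<alpha> P h n 0 = real n * (real n + 2 * \<alpha>) \<and>
    ((2 * real n - 1 + 2 * \<alpha>) * (2 * real n + 1 + 2 * \<alpha>) \<noteq> 0 \<longrightarrow>
      H' 0 = - (2 * real n * (2 * (real n)^2 + 2 * real n * \<alpha> - 1))
               / ((2 * real n - 1 + 2 * \<alpha>) * (2 * real n + 1 + 2 * \<alpha>)))"
proof -
  interpret gauss_gegenbauer_family \<alpha> P h
    by unfold_locales (rule alpha, rule P)
  obtain H2 where H2: "\<And>t. (H_deriv n has_real_derivative H2 t) (at t)"
    using H_deriv_differentiable by blast
  show ?thesis
  proof (rule exI[of _ "H_deriv n"], rule exI[of _ H2], intro conjI allI impI)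
    show "(H \<alpha> P h n has_real_derivative H_deriv n t) (at t)" for t by (rule DERIV_H)
    show "(H_deriv n has_real_derivative H2 t) (at t)" for t by (rule H2)
  next
    fix t :: real
    define Q where "Q = fixed_t.r t n + (t + \<alpha>)"
    have r: "Q - (t + \<alpha>) = fixed_t.r t n" by (simp add: Q_def)
    have "Q\<^sup>2 = H \<alpha> P h n t - 2 * t * H_deriv n t + (t + \<alpha>)\<^sup>2"
      using r_completed_square[where n=n and t=t] by (simp add: Q_def power2_eq_square algebra_simps)
    moreover have "t * (2 * t * H2 t + H_deriv n t + 2 * (Q - (t + \<alpha>)))\<^sup>2 =
        Q\<^sup>2 * (4 * t * (H_deriv n t + 2 * (Q - (t + \<alpha>)))\<^sup>2
          - 8 * (real n - (Q - (t + \<alpha>))) * ((Q - (t + \<alpha>))\<^sup>2 + 2 * \<alpha> * (Q - (t + \<alpha>))))"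
      using r_first_order[OF H2[of t]] unfolding r by (simp only: Q_def)
    ultimately show "(4 * t^3 * (H2 t)^2 + 4 * t^2 * H2 t * (H_deriv n t - 2 * (t + \<alpha>)) + 8 * t^2 * (H_deriv n t)^3
        - t * (H_deriv n t)^2 * (4 * H \<alpha> P h n t + 4 * (t + \<alpha>)^2 - 32 * real n * t - 1)
        - 4 * t * H_deriv n t * (4 * (2 * real n + \<alpha> + t) * H \<alpha> P h n t
            + (3 * t + \<alpha>) * (4 * real n * t + 4 * real n * \<alpha> + 1))
        + 8 * (real n + \<alpha> + t) * (H \<alpha> P h n t)^2
        + 4 * H \<alpha> P h n t * (2 * t^3 + 6 * t^2 * (real n + \<alpha>)
            + t * (8 * real n * \<alpha> + 6 * \<alpha>^2 + 1) + 2 * \<alpha>^2 * (real n + \<alpha>))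
        + 8 * t * (t + \<alpha>)^2 * (2 * real n * (t + \<alpha>) + 1))^2
      = 16 * (H \<alpha> P h n t - 2 * t * H_deriv n t + (t + \<alpha>)^2)
        * (2 * t^2 * H2 t + t * (4 * H \<alpha> P h n t + 8 * real n * t + 1) * H_deriv n t
            - 2 * (H \<alpha> P h n t)^2
            - 2 * H \<alpha> P h n t * (2 * real n * t + (t + \<alpha>)^2)
            - 2 * t * (t + \<alpha>) * (2 * real n * (t + \<alpha>) + 1))^2" by (rule quartic_resolvent)
  next
    show "H \<alpha> P h n 0 = real n * (real n + 2 * \<alpha>)"
      by (simp add: H_eq power2_eq_square algebra_simps)
  next
    let ?D = "(2 * real n - 1 + 2 * \<alpha>) * (2 * real n + 1 + 2 * \<alpha>)"
    assume D: "?D \<noteq> 0"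
    have "b n 0 * ?D = real n * (real n + 2 * \<alpha>)"
      using r_quadratic_explicit[where n=n and t=0] by (simp add: fixed_t.r_def power2_eq_square algebra_simps)
    have "H_deriv n 0 = 4 * (real n + \<alpha>) * b n 0 - 2 * real n"
      using fixed_t.string_equation[where n=n and t=0] by (simp add: H_deriv_def algebra_simps)
    hence "H_deriv n 0 * ?D = 4 * (real n + \<alpha>) * (b n 0 * ?D) - 2 * real n * ?D"
      by algebra
    also have "\<dots> = - (2 * real n * (2 * (real n)\<^sup>2 + 2 * real n * \<alpha> - 1))"
      unfolding \<open>b n 0 * ?D = _\<close> by algebra
    finally show "H_deriv n 0 = - (2 * real n * (2 * (real n)\<^sup>2 + 2 * real n * \<alpha> - 1)) / ?D"
      by (rule eq_divide_imp[OF D])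
  qed
qed

end
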